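(* Every totally orderable betweenness on a finite set is an abstract causal betweenness.
   Context: A ternary relation $\mathcal{B}$ is a betweenness if for all $A,B,C$ in its ground set: $(A,B,C)\in\mathcal{B}$ implies that $A,B,C$ are all distinct; $(A,B,C)\in\mathcal{B}$ implies $(C,B,A)\in\mathcal{B}$; and $(A,B,C)\in\mathcal{B}$ implies $(C,A,B)\notin\mathcal{B}$. A ternary relation $\mathcal{B}$ on a finite set is totally orderable if and only if there is a mapping $t$ from the ground set of $\mathcal{B}$ to a set with a (strict) total order $\prec$ such that $$(A,B,C)\in\mathcal{B}\;\Rightarrow\;\bigl(t(A)\prec t(B)\prec t(C)\ \text{ or }\ t(C)\prec t(B)\prec t(A)\bigr).$$ A finite probability space is an ordered pair $(S,p)$ where $S$ is a finite set and $p:S\to[0,1]$ is a function with $\sum_{s\in S}p(s)=1$. Subsets of $S$ are called events; for events $A,B$, write $AB=A\cap B$, $P(A)=\sum_{s\in A}p(s)$, and, when $P(B)>0$, $P(A|B)=P(AB)/P(B)$. An event $B$ is causally between events $A$ and $C$ if all of the following hold: (1) $P(AC)>P(A)\cdot P(C)$; (2) $P(C|B)>P(C|A)$; (3) $P(A|B)>P(A|C)$; (4) $P(AC|B)=P(A|B)\cdot P(C|B)$; (5) $P(B-A)>0$ and $P(B-C)>0$ (where $-$ denotes set difference). (The conditional probabilities are well defined, since (1) guarantees $P(A)>0$ and $P(C)>0$, and (5) guarantees $P(B)>0$.) Given a set $X$ of events in a finite probability space, $\mathcal{CB}(X)$ denotes the ternary relation on the ground set $X$ consisting of all ordered triples $(A,B,C)$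 of events in $X$ satisfying (1)--(5). A ternary relation $\mathcal{B}$ on a finite ground set is an abstract causal betweenness if and only if there is a set $X$ of events in a finite probability space such that $\mathcal{CB}(X)$ is isomorphic to $\mathcal{B}$ (i.e. there is a bijection between the ground set of $\mathcal{B}$ and $X$ under which a triple is in $\mathcal{B}$ exactly when its image is in $\mathcal{CB}(X)$). *)

theory Defs imports Complex_Main begin

text \<open>
  A ternary relation is a set of triples together with an explicit ground set \<open>V\<close>.
\<close>

definition betweenness_on :: "'a set \<Rightarrow> ('a \<times> 'a \<times> 'a) set \<Rightarrow> bool" where
  "betweenness_on V R \<longleftrightarrow>
     R \<subseteq> V \<times> V \<times> V \<and>
     (\<forall>a\<in>V. \<forall>b\<in>V. \<forall>c\<in>V.
        ((a, b, c) \<in> R \<longrightarrow> a \<noteq> b \<and> b \<noteq> c \<and> a \<noteq> c) \<and>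
        ((a, b, c) \<in> R \<longrightarrow> (c, b, a) \<in> R) \<and>
        ((a, b, c) \<in> R \<longrightarrow> (c, a, b) \<notin> R))"

text \<open>
  The map \<open>t\<close> need not be injective and \<open>r\<close> is an arbitrary strict total order on \<open>T\<close>,
  unrelated to the usual order of the natural numbers. For finite \<open>V\<close> taking \<open>T\<close>
  inside \<^typ>\<open>nat\<close> is no restriction: see \<open>totally_orderable_onI\<close> below.
\<close>

definition totally_orderable_on :: "'a set \<Rightarrow> ('a \<times> 'a \<times> 'a) set \<Rightarrow> bool" where
  "totally_orderable_on V R \<longleftrightarrow>
     (\<exists>(t :: 'a \<Rightarrow> nat) T r.
        strict_linear_order_on T r \<and> t ` V \<subseteq> T \<and>
        (\<forall>a\<in>V. \<forall>b\<in>V. \<forall>c\<in>V. (a, b, c) \<in> R \<longrightarrow>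
           ((t a, t b) \<in> r \<and> (t b, t c) \<in> r) \<or> ((t c, t b) \<in> r \<and> (t b, t a) \<in> r)))"

definition finite_prob_space :: "'s set \<Rightarrow> ('s \<Rightarrow> real) \<Rightarrow> bool" where
  "finite_prob_space S p \<longleftrightarrow> finite S \<and> (\<forall>s\<in>S. p s \<in> {0..1}) \<and> (\<Sum>s\<in>S. p s) = 1"

definition event_prob :: "('s \<Rightarrow> real) \<Rightarrow> 's set \<Rightarrow> real" where
  "event_prob p A = (\<Sum>s\<in>A. p s)"

definition event_cond_prob :: "('s \<Rightarrow> real) \<Rightarrow> 's set \<Rightarrow> 's set \<Rightarrow> real" where
  "event_cond_prob p A B = event_prob p (A \<inter> B) / event_prob p B"

text \<open>
  Division by zero plays no role here: for events of a finite probability space, the first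
  conjunct forces \<open>P A > 0\<close> and \<open>P C > 0\<close>, and the last two force \<open>P B > 0\<close>.
\<close>

definition causally_between :: "('s \<Rightarrow> real) \<Rightarrow> 's set \<Rightarrow> 's set \<Rightarrow> 's set \<Rightarrow> bool" where
  "causally_between p A B C \<longleftrightarrow>
     event_prob p (A \<inter> C) > event_prob p A * event_prob p C \<and>
     event_cond_prob p C B > event_cond_prob p C A \<and>
     event_cond_prob p A B > event_cond_prob p A C \<and>
     event_cond_prob p (A \<inter> C) B = event_cond_prob p A B * event_cond_prob p C B \<and>
     event_prob p (B - A) > 0 \<and> event_prob p (B - C) > 0"

definition causal_betweenness ::
  "('s \<Rightarrow> real) \<Rightarrow> 's set set \<Rightarrow> ('s set \<times> 's set \<times> 's set) set" where
  "causal_betweenness p X =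
     {(A, B, C). A \<in> X \<and> B \<in> X \<and> C \<in> X \<and> causally_between p A B C}"

definition ternary_isomorphic ::
  "'a set \<Rightarrow> ('a \<times> 'a \<times> 'a) set \<Rightarrow> 'b set \<Rightarrow> ('b \<times> 'b \<times> 'b) set \<Rightarrow> bool" where
  "ternary_isomorphic V R W Q \<longleftrightarrow>
     (\<exists>f. bij_betw f V W \<and>
        (\<forall>a\<in>V. \<forall>b\<in>V. \<forall>c\<in>V. (a, b, c) \<in> R \<longleftrightarrow> (f a, f b, f c) \<in> Q))"

text \<open>
  HOL cannot quantify over the type of sample points; since sample spaces are finite,
  subsets of \<^typ>\<open>nat\<close> suffice: see \<open>abstract_causal_betweenness_onI\<close> below.
\<close>

definition abstract_causal_betweenness_on :: "'a set \<Rightarrow> ('a \<times> 'a \<times> 'a) set \<Rightarrow> bool" where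
  "abstract_causal_betweenness_on V R \<longleftrightarrow>
     finite V \<and> R \<subseteq> V \<times> V \<times> V \<and>
     (\<exists>(S :: nat set) p X. finite_prob_space S p \<and> X \<subseteq> Pow S \<and>
        ternary_isomorphic V R X (causal_betweenness p X))"

lemma totally_orderable_onI:
  fixes t :: "'a \<Rightarrow> 'b"
  assumes "finite V" and r: "strict_linear_order_on T r" and t: "t ` V \<subseteq> T"
    and ord: "\<And>a b c. a \<in> V \<Longrightarrow> b \<in> V \<Longrightarrow> c \<in> V \<Longrightarrow> (a, b, c) \<in> R \<Longrightarrow>
      ((t a, t b) \<in> r \<and> (t b, t c) \<in> r) \<or> ((t c, t b) \<in> r \<and> (t b, t a) \<in> r)"
  shows "totally_orderable_on V R"
proof -
  define W where "W = t ` V"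
  have "finite W" "W \<subseteq> T" using assms(1) t by (auto simp: W_def)
  then obtain g :: "'b \<Rightarrow> nat" where g: "inj_on g W"
    using finite_imp_inj_to_nat_seg by blast
  define q where "q = {(g x, g y) | x y. x \<in> W \<and> y \<in> W \<and> (x, y) \<in> r}"
  have mem: "(g x, g y) \<in> q \<longleftrightarrow> (x, y) \<in> r" if "x \<in> W" "y \<in> W" for x y
    using that inj_onD[OF g] unfolding q_def by blast
  have q_sub: "q \<subseteq> g ` W \<times> g ` W" unfolding q_def by blast
  have tr: "trans r" and irr: "irrefl r" and tot: "total_on T r"
    using r by (auto simp: strict_linear_order_on_def)
  have "trans q"
  proof (rule transI)
    fix u v w assume uv: "(u, v) \<in> q" and vw: "(v, w) \<in> q"
    then obtain x y z where "x \<in> W" "y \<in> W" "z \<in> W" "u = g x" "v = g y" "w = g z"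
      using q_sub by blast
    then show "(u, w) \<in> q" using uv vw mem tr by (metis transD)
  qed
  moreover have "irrefl q"
  proof (rule irreflI)
    fix u show "(u, u) \<notin> q"
    proof
      assume "(u, u) \<in> q"
      moreover from this obtain x where "x \<in> W" "u = g x" using q_sub by blast
      ultimately show False using mem irr by (simp add: irrefl_def)
    qed
  qed
  moreover have "total_on (g ` W) q"
  proof (rule total_onI)
    fix u v assume "u \<in> g ` W" "v \<in> g ` W" "u \<noteq> v"
    then obtain x y where xy: "x \<in> W" "y \<in> W" "u = g x" "v = g y" "x \<noteq> y" by blast
    then have "(x, y) \<in> r \<or> (y, x) \<in> r" using tot \<open>W \<subseteq> T\<close> by (metis subsetD total_on_def)
    then show "(u, v) \<in> q \<or> (v, u) \<in> q" using xy mem by simp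
  qed
  ultimately have q: "strict_linear_order_on (g ` W) q"
    by (simp add: strict_linear_order_on_def)
  have "t a \<in> W" if "a \<in> V" for a using that by (simp add: W_def)
  with ord mem have "((g (t a), g (t b)) \<in> q \<and> (g (t b), g (t c)) \<in> q) \<or>
      ((g (t c), g (t b)) \<in> q \<and> (g (t b), g (t a)) \<in> q)"
    if "a \<in> V" "b \<in> V" "c \<in> V" "(a, b, c) \<in> R" for a b c
    using that by meson
  then show ?thesis unfolding totally_orderable_on_def
    by (intro exI[of _ "\<lambda>a. g (t a)"] exI[of _ "g ` W"] exI[of _ q])
       (use q in \<open>auto simp: W_def\<close>)
qed

lemma abstract_causal_betweenness_onI:
  fixes S :: "'s set"
  assumes V: "finite V" "R \<subseteq> V \<times> V \<times> V"
    and S: "finite_prob_space S p" and X: "X \<subseteq> Pow S"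
    and iso: "ternary_isomorphic V R X (causal_betweenness p X)"
  shows "abstract_causal_betweenness_on V R"
proof -
  have "finite S" using S by (simp add: finite_prob_space_def)
  then obtain g :: "'s \<Rightarrow> nat" where g: "inj_on g S"
    using finite_imp_inj_to_nat_seg by blast
  define p' where "p' = p \<circ> inv_into S g"
  have P: "event_prob p' (g ` A) = event_prob p A" if "A \<subseteq> S" for A
  proof -
    have "sum p' (g ` A) = sum (p' \<circ> g) A"
      using g that by (intro sum.reindex) (rule inj_on_subset)
    also have "\<dots> = sum p A"
      using g that by (intro sum.cong) (auto simp: p'_def)
    finally show ?thesis by (simp add: event_prob_def)
  qed
  have CB: "causally_between p' (g ` A) (g ` B) (g ` C) = causally_between p A B C"
    if "A \<subseteq> S" "B \<subseteq> S" "C \<subseteq> S" for A B C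
  proof -
    have I: "g ` D \<inter> g ` E = g ` (D \<inter> E)" "g ` D - g ` E = g ` (D - E)"
      if "D \<subseteq> S" "E \<subseteq> S" for D E
      using g that inj_on_image_Int[of g S D E] inj_on_image_set_diff[of g S D E] by auto
    show ?thesis
      using that by (simp add: causally_between_def event_cond_prob_def I P le_infI1 subset_trans[OF Diff_subset])
  qed
  have sp: "finite_prob_space (g ` S) p'"
    using S g P[of S] by (auto simp: finite_prob_space_def event_prob_def p'_def)
  have inj: "inj_on ((`) g) X"
    using inj_on_image_Pow[OF g] X by (rule inj_on_subset)
  obtain f where f: "bij_betw f V X"
    and R: "\<And>a b c. a \<in> V \<Longrightarrow> b \<in> V \<Longrightarrow> c \<in> V \<Longrightarrow>
      (a, b, c) \<in> R \<longleftrightarrow> (f a, f b, f c) \<in> causal_betweenness p X"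
    using iso unfolding ternary_isomorphic_def by blast
  have bij: "bij_betw ((`) g \<circ> f) V ((`) g ` X)"
    using f inj by (meson bij_betw_trans inj_on_imp_bij_betw)
  have "(a, b, c) \<in> R \<longleftrightarrow>
      (((`) g \<circ> f) a, ((`) g \<circ> f) b, ((`) g \<circ> f) c) \<in> causal_betweenness p' ((`) g ` X)"
    if "a \<in> V" "b \<in> V" "c \<in> V" for a b c
  proof -
    have fX: "f a \<in> X" "f b \<in> X" "f c \<in> X" using that f by (auto simp: bij_betw_def)
    then have "f a \<subseteq> S" "f b \<subseteq> S" "f c \<subseteq> S" using X by auto
    then show ?thesis using fX R[OF that] by (simp add: causal_betweenness_def CB)
  qed
  then have "ternary_isomorphic V R ((`) g ` X) (causal_betweenness p' ((`) g ` X))"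
    using bij unfolding ternary_isomorphic_def by blast
  moreover have "(`) g ` X \<subseteq> Pow (g ` S)" using X by auto
  ultimately show ?thesis
    using V sp unfolding abstract_causal_betweenness_on_def by blast
qed

end

theory Submission imports Defs begin

text \<open>
  Let \<open>u\<close> rank the ground set \<open>V\<close> along the given order, and let \<open>d\<close> be the spread of \<open>u\<close> on a
  set. Take the subsets of \<open>V\<close> as sample points, the events \<open>a \<in> s\<close>, and a density given by its
  Walsh expansion \<open>2 ^ (- \<bar>V\<bar>) * (\<Sum>U\<subseteq>V. g U * \<chi>\<^sub>U)\<close>, which is nonnegative when the
  coefficients at nonempty sets are small. All events have probability \<open>1/2\<close>. With
  \<open>g {a, b} = \<kappa> / 2 ^ d {a, b}\<close> and \<open>\<kappa> = 2 ^ (- \<bar>V\<bar>)\<close>, conditions (1)--(3) and (5) say that \<open>u b\<close> lies strictly between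
  \<open>u a\<close> and \<open>u c\<close>, and (4) becomes \<open>g {a, c} + g {a, b, c} = g {a, b} * g {b, c}\<close>. The coefficient
  \<open>g {a, b, c}\<close> affects no pair of events, so (4) can be switched on or off for each triple separately.
\<close>

section \<open>Walsh functions and densities on the subsets of \<open>V\<close>\<close>

definition walsh :: "'a set \<Rightarrow> 'a set \<Rightarrow> real" where
  "walsh U s = (-1) ^ card (U - s)"

text \<open>\<open>walsh U s\<close> is a product of signs over the elements of \<open>U\<close>: +1
  for those in \<open>s\<close>, -1 for the others. If \<open>U \<subseteq> A\<close>, all signs are
  +1; otherwise toggling an element of \<open>U - A\<close> in \<open>s\<close> reverses the sign,
  so the terms cancel in pairs.\<close>

lemma sum_walsh_supersets:
  assumes "finite V" "A \<subseteq> V" "U \<subseteq> V"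
  shows "(\<Sum>s | s \<subseteq> V \<and> A \<subseteq> s. walsh U s) = (if U \<subseteq> A then 2 ^ card V / 2 ^ card A else 0)"
proof (cases "U \<subseteq> A")
  case True
  have "bij_betw (\<lambda>w. A \<union> w) (Pow (V - A)) {s. s \<subseteq> V \<and> A \<subseteq> s}"
    by (rule bij_betw_byWitness[where f' = "\<lambda>s. s - A"]) (use assms in auto)
  then have "card {s. s \<subseteq> V \<and> A \<subseteq> s} = 2 ^ (card V - card A)"
    using assms by (simp flip: bij_betw_same_card add: card_Pow card_Diff_subset finite_subset)
  moreover have "2 ^ (card V - card A) = (2 ^ card V / 2 ^ card A :: real)"
    using assms by (intro power_diff) (simp_all add: card_mono)
  moreover have "walsh U s = 1" if "A \<subseteq> s" for s
  proof -
    have "U - s = {}" using True that by blast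
    then show ?thesis unfolding walsh_def by (simp only: card.empty power_0)
  qed
  ultimately show ?thesis
    using True by simp
next
  case False
  then obtain u where u: "u \<in> U" "u \<notin> A" by blast
  define flip where "flip = (\<lambda>s. if u \<in> s then s - {u} else insert u s)"
  have finU: "finite U" using assms finite_subset by blast
  have walsh_flip: "walsh U (flip s) = - walsh U s" for s
  proof (cases "u \<in> s")
    case True
    then have "U - flip s = insert u (U - s)" using u by (auto simp: flip_def)
    then show ?thesis using True finU by (simp add: walsh_def)
  next
    case False
    then have "U - s = insert u (U - flip s)" "u \<notin> U - flip s" using u by (auto simp: flip_def)
    then show ?thesis using finU by (simp add: walsh_def)
  qed
  have "(\<Sum>s | s \<subseteq> V \<and> A \<subseteq> s. walsh U s) = (\<Sum>s | s \<subseteq> V \<and> A \<subseteq> s. - walsh U s)"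
    by (rule sum.reindex_bij_witness[where i = flip and j = flip])
       (use u assms walsh_flip in \<open>auto simp: flip_def split: if_splits\<close>)
  then show ?thesis using False by (simp add: sum_negf)
qed

definition walsh_density :: "'a set \<Rightarrow> ('a set \<Rightarrow> real) \<Rightarrow> 'a set \<Rightarrow> real" where
  "walsh_density V g s = (\<Sum>U\<in>Pow V. g U * walsh U s) / 2 ^ card V"

text \<open>Only coefficients at subsets of \<open>A\<close> survive the summation, so joint
  probabilities of few events depend on few coefficients.\<close>

lemma event_prob_walsh_density:
  assumes "finite V" "A \<subseteq> V"
  shows "event_prob (walsh_density V g) {s. s \<subseteq> V \<and> A \<subseteq> s} = (\<Sum>U\<in>Pow A. g U) / 2 ^ card A"
proof -
  have "event_prob (walsh_density V g) {s. s \<subseteq> V \<and> A \<subseteq> s}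
      = (\<Sum>U\<in>Pow V. g U * (\<Sum>s | s \<subseteq> V \<and> A \<subseteq> s. walsh U s)) / 2 ^ card V"
    unfolding event_prob_def walsh_density_def sum_divide_distrib[symmetric] sum_distrib_left
    by (subst sum.swap) simp
  also have "\<dots> = (\<Sum>U\<in>Pow V. if U \<subseteq> A then g U * (2 ^ card V / 2 ^ card A) else 0) / 2 ^ card V"
    using assms by (intro arg_cong2[of _ _ _ _ "(/)"] sum.cong) (auto simp: sum_walsh_supersets)
  also have "\<dots> = (\<Sum>U\<in>Pow A. g U * (2 ^ card V / 2 ^ card A)) / 2 ^ card V"
    using assms by (intro arg_cong2[of _ _ _ _ "(/)"] refl sum.mono_neutral_cong_right) auto
  finally show ?thesis
    by (simp add: sum_divide_distrib flip: sum_distrib_right)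
qed

text \<open>The constant term 1 outweighs the others: there are fewer than \<open>2 ^ card V\<close>
  of them, each at most \<open>1 / 2 ^ card V\<close> in absolute value.\<close>

lemma finite_prob_space_walsh_density:
  assumes "finite V" "g {} = 1"
    and small: "\<And>U. U \<subseteq> V \<Longrightarrow> U \<noteq> {} \<Longrightarrow> \<bar>g U\<bar> \<le> 1 / 2 ^ card V"
  shows "finite_prob_space (Pow V) (walsh_density V g)"
proof -
  have nonneg: "walsh_density V g s \<ge> 0" for s
  proof -
    have "\<bar>\<Sum>U\<in>Pow V - {{}}. g U * walsh U s\<bar> \<le> (\<Sum>U\<in>Pow V - {{}}. 1 / 2 ^ card V)"
      by (rule order_trans[OF sum_abs sum_mono])
         (use small in \<open>auto simp: abs_mult walsh_def power_abs\<close>)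
    also have "\<dots> \<le> (\<Sum>U\<in>Pow V. 1 / 2 ^ card V)"
      using assms(1) by (intro sum_mono2) auto
    also have "\<dots> = 1"
      using assms(1) by (simp add: card_Pow)
    finally have "\<bar>\<Sum>U\<in>Pow V - {{}}. g U * walsh U s\<bar> \<le> 1" .
    moreover have "(\<Sum>U\<in>Pow V. g U * walsh U s) = 1 + (\<Sum>U\<in>Pow V - {{}}. g U * walsh U s)"
      using assms by (subst sum.remove[of _ "{}"]) (auto simp: walsh_def)
    ultimately show ?thesis
      by (simp add: walsh_density_def)
  qed
  \<comment> \<open>Every subset contains \<open>{}\<close>, so the total mass is the superset
    formula at \<open>A = {}\<close>.\<close>
  have total: "(\<Sum>s\<in>Pow V. walsh_density V g s) = 1"
    using event_prob_walsh_density[OF assms(1), of "{}" g] assms(2)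
    by (simp add: event_prob_def Pow_def)
  have "walsh_density V g s \<le> 1" if "s \<in> Pow V" for s
    using member_le_sum[of s "Pow V" "walsh_density V g"] that nonneg total assms(1) by simp
  then show ?thesis
    using nonneg total assms(1) by (simp add: finite_prob_space_def)
qed

lemma sum_Pow_insert:
  fixes g :: "'a set \<Rightarrow> real"
  assumes "finite A" "a \<notin> A"
  shows "(\<Sum>U\<in>Pow (insert a A). g U) = (\<Sum>U\<in>Pow A. g U) + (\<Sum>U\<in>Pow A. g (insert a U))"
proof -
  have "inj_on (insert a) (Pow A)"
    using assms(2) by (auto simp: inj_on_def)
  moreover have "Pow A \<inter> insert a ` Pow A = {}"
    using assms(2) by auto
  ultimately show ?thesis
    using assms(1) by (simp add: Pow_insert sum.union_disjoint sum.reindex)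
qed

section \<open>Spreads and ranks\<close>

definition spread :: "('a \<Rightarrow> nat) \<Rightarrow> 'a set \<Rightarrow> nat" where
  "spread u U = Max (u ` U) - Min (u ` U)"

lemma spread_pair: "spread u {a, b} = max (u a) (u b) - min (u a) (u b)"
  by (simp add: spread_def)

definition strictly_between :: "nat \<Rightarrow> nat \<Rightarrow> nat \<Rightarrow> bool" where
  "strictly_between i j k \<longleftrightarrow> i < j \<and> j < k \<or> k < j \<and> j < i"

text \<open>Of three points on a line, the two outer ones are farthest apart. Conditions (2) and (3)
  compare pairs and so yield betweenness in this form.\<close>

lemma strictly_between_iff_spread:
  "strictly_between (u a) (u b) (u c) \<longleftrightarrow>
     spread u {b, c} < spread u {a, c} \<and> spread u {a, b} < spread u {a, c}"
  unfolding spread_pair strictly_between_def by linarith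

lemma spread_strictly_between:
  assumes "strictly_between (u a) (u b) (u c)"
  shows "spread u {a, b, c} = spread u {a, c}"
    and "spread u {a, b} + spread u {b, c} = spread u {a, c}"
  using assms by (auto simp: spread_def strictly_between_def)

text \<open>The rank of \<open>a\<close> counts the elements of \<open>V\<close> below
  \<open>t a\<close>. When \<open>t a\<close> is below \<open>t b\<close>, transitivity gives
  inclusion of the counted sets, and \<open>a\<close> itself is in the second but, by irreflexivity,
  not in the first.\<close>

lemma order_rank:
  fixes t :: "'a \<Rightarrow> 'b"
  assumes "finite V" "trans r" "irrefl r"
  obtains u :: "'a \<Rightarrow> nat" where
    "\<And>a b. a \<in> V \<Longrightarrow> (t a, t b) \<in> r \<Longrightarrow> u a < u b"
proof
  fix a b assume "a \<in> V" "(t a, t b) \<in> r"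
  then have "{x \<in> V. (t x, t a) \<in> r} \<subset> {x \<in> V. (t x, t b) \<in> r}"
    using assms(2,3) by (auto simp: irrefl_def dest: transD)
  then show "card {x \<in> V. (t x, t a) \<in> r} < card {x \<in> V. (t x, t b) \<in> r}"
    using assms(1) by (intro psubset_card_mono) auto
qed

lemma totally_orderable_on_rank:
  assumes "finite V" "R \<subseteq> V \<times> V \<times> V" "totally_orderable_on V R"
  obtains u :: "'a \<Rightarrow> nat" where
    "\<And>a b c. (a, b, c) \<in> R \<Longrightarrow> strictly_between (u a) (u b) (u c)"
proof -
  obtain t :: "'a \<Rightarrow> nat" and T r where r: "strict_linear_order_on T r"
    and "t ` V \<subseteq> T"
    and ord: "\<forall>a\<in>V. \<forall>b\<in>V. \<forall>c\<in>V. (a, b, c) \<in> R \<longrightarrow>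
      ((t a, t b) \<in> r \<and> (t b, t c) \<in> r) \<or> ((t c, t b) \<in> r \<and> (t b, t a) \<in> r)"
    using assms(3) unfolding totally_orderable_on_def by (elim exE conjE)
  have "trans r" "irrefl r"
    using r by (auto simp: strict_linear_order_on_def)
  then obtain u :: "'a \<Rightarrow> nat" where u: "\<And>a b. a \<in> V \<Longrightarrow> (t a, t b) \<in> r \<Longrightarrow> u a < u b"
    using order_rank[OF assms(1)] by blast
  show thesis
  proof
    fix a b c assume "(a, b, c) \<in> R"
    then show "strictly_between (u a) (u b) (u c)"
      using ord u assms(2) unfolding strictly_between_def by blast
  qed
qed

section \<open>Coefficients of the density\<close>

definition coeff_scale :: "'a set \<Rightarrow> real" where
  "coeff_scale V = 1 / 2 ^ card V"

definition pair_coeff :: "'a set \<Rightarrow> ('a \<Rightarrow> nat) \<Rightarrow> 'a set \<Rightarrow> real" where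
  "pair_coeff V u U = coeff_scale V / 2 ^ spread u U"

text \<open>
  If \<open>u b\<close> is strictly between \<open>u a\<close> and \<open>u c\<close>, then \<open>pair_coeff\<close> takes the same value at
  \<open>{a, b, c}\<close> and \<open>{a, c}\<close>, so the two cases for triples differ by \<open>g {a, c}\<close>.
\<close>
definition triple_coeffs ::
  "'a set \<Rightarrow> ('a \<times> 'a \<times> 'a) set \<Rightarrow> ('a \<Rightarrow> nat) \<Rightarrow> 'a set \<Rightarrow> real" where
  "triple_coeffs V R u U =
     (if U = {} then 1
      else if card U = 2 then pair_coeff V u U
      else if card U = 3 then coeff_scale V * pair_coeff V u U -
        (if \<exists>(a, b, c)\<in>R. U = {a, b, c} then pair_coeff V u U else 0)
      else 0)"

lemma coeff_scale_bounds: "0 < coeff_scale V" "coeff_scale V \<le> 1"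
  by (simp_all add: coeff_scale_def)

lemma coeff_scale_less_1: "finite V \<Longrightarrow> V \<noteq> {} \<Longrightarrow> coeff_scale V < 1"
  by (simp add: coeff_scale_def card_gt_0_iff)

lemma pair_coeff_bounds: "0 < pair_coeff V u U" "pair_coeff V u U \<le> coeff_scale V"
  using coeff_scale_bounds(1)[of V] by (simp_all add: pair_coeff_def divide_le_eq)

lemma pair_coeff_less_iff: "pair_coeff V u U < pair_coeff V u W \<longleftrightarrow> spread u W < spread u U"
  using coeff_scale_bounds(1)[of V] by (simp add: pair_coeff_def field_simps)

text \<open>At a triple the coefficient is \<open>p\<close> or \<open>p - pair_coeff V u U\<close>,
  where \<open>p\<close> lies between 0 and \<open>pair_coeff V u U\<close>, so the subtraction
  stays within the bound.\<close>

lemma abs_triple_coeffs_le: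
  assumes "U \<noteq> {}"
  shows "\<bar>triple_coeffs V R u U\<bar> \<le> coeff_scale V"
proof -
  have k: "0 < coeff_scale V" "coeff_scale V \<le> 1"
    and r: "0 < pair_coeff V u U" "pair_coeff V u U \<le> coeff_scale V"
    by (fact coeff_scale_bounds pair_coeff_bounds)+
  define p where "p = coeff_scale V * pair_coeff V u U"
  have "0 \<le> p" "p \<le> pair_coeff V u U"
    using k r by (simp_all add: p_def mult_le_cancel_right1)
  then show ?thesis
    using assms k r by (simp add: triple_coeffs_def abs_le_iff flip: p_def)
qed

text \<open>A coefficient sees only the unordered triple. The order is recovered from the ranks,
  which fix the middle element, and from the symmetry of \<open>R\<close> in the outer two.\<close>

lemma middle_triple_in_iff:
  assumes R: "betweenness_on V R"
    and u: "\<And>a b c. (a, b, c) \<in> R \<Longrightarrow> strictly_between (u a) (u b) (u c)"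
    and abc: "strictly_between (u a) (u b) (u c)"
  shows "(\<exists>(a', b', c')\<in>R. {a, b, c} = {a', b', c'}) \<longleftrightarrow> (a, b, c) \<in> R"
proof
  assume "\<exists>(a', b', c')\<in>R. {a, b, c} = {a', b', c'}"
  then obtain a' b' c' where R': "(a', b', c') \<in> R" and eq: "{a, b, c} = {a', b', c'}" by blast
  have bet: "strictly_between (u a') (u b') (u c')" by (rule u[OF R'])
  have mem: "a' \<in> {a, b, c}" "b' \<in> {a, b, c}" "c' \<in> {a, b, c}" using eq by auto
  have sym: "(c', b', a') \<in> R"
    using R R' unfolding betweenness_on_def by blast
  have "b' = b \<and> (a' = a \<and> c' = c \<or> a' = c \<and> c' = a)"
    using mem bet abc by (auto simp: strictly_between_def)
  then show "(a, b, c) \<in> R"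
    using R' sym by auto
qed auto

section \<open>Membership events and their probabilities\<close>

definition membership_event :: "'a set \<Rightarrow> 'a \<Rightarrow> 'a set set" where
  "membership_event V a = {s. s \<subseteq> V \<and> {a} \<subseteq> s}"

lemma membership_event_Int:
  "membership_event V a \<inter> membership_event V b = {s. s \<subseteq> V \<and> {a, b} \<subseteq> s}"
  by (auto simp: membership_event_def)

context
  fixes V :: "'a set" and R :: "('a \<times> 'a \<times> 'a) set" and u :: "'a \<Rightarrow> nat"
  assumes fin: "finite V"
begin

abbreviation "dens \<equiv> walsh_density V (triple_coeffs V R u)"

lemma event_prob_single:
  "a \<in> V \<Longrightarrow> event_prob dens (membership_event V a) = 1 / 2"
  using event_prob_walsh_density[OF fin, of "{a}" "triple_coeffs V R u"]
  by (simp add: membership_event_def sum_Pow_insert triple_coeffs_def)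

lemma event_prob_pair:
  assumes "a \<in> V" "b \<in> V" "a \<noteq> b"
  shows "event_prob dens {s. s \<subseteq> V \<and> {a, b} \<subseteq> s} = (1 + pair_coeff V u {a, b}) / 4"
proof -
  have "{a, b} \<subseteq> V" using assms by blast
  from event_prob_walsh_density[OF fin this, of "triple_coeffs V R u"] show ?thesis
    using assms by (simp add: sum_Pow_insert triple_coeffs_def del: insert_subset)
qed

lemma event_prob_triple:
  assumes "a \<in> V" "b \<in> V" "c \<in> V" "a \<noteq> b" "a \<noteq> c" "b \<noteq> c"
  shows "event_prob dens {s. s \<subseteq> V \<and> {a, b, c} \<subseteq> s} =
    (1 + pair_coeff V u {a, b} + pair_coeff V u {a, c} + pair_coeff V u {b, c}
       + triple_coeffs V R u {a, b, c}) / 8"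
proof -
  have "{a, b, c} \<subseteq> V" using assms by blast
  moreover have "triple_coeffs V R u {x} = 0" for x
    by (simp add: triple_coeffs_def)
  moreover have "triple_coeffs V R u {x, y} = pair_coeff V u {x, y}" if "x \<noteq> y" for x y
    using that by (simp add: triple_coeffs_def)
  moreover have "triple_coeffs V R u {} = 1"
    by (simp add: triple_coeffs_def)
  ultimately show ?thesis
    using event_prob_walsh_density[OF fin, of "{a, b, c}" "triple_coeffs V R u"] assms
    by (simp add: sum_Pow_insert del: insert_subset)
qed

lemma event_prob_membership_diff:
  assumes "a \<in> V" "b \<in> V" "a \<noteq> b"
  shows "event_prob dens (membership_event V b - membership_event V a)
    = (1 - pair_coeff V u {a, b}) / 4"
proof -
  have "finite (membership_event V b)"
    using fin by (simp add: membership_event_def)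
  from sum.Int_Diff[OF this, of dens "membership_event V a"]
  have "event_prob dens (membership_event V b - membership_event V a)
    = event_prob dens (membership_event V b)
      - event_prob dens (membership_event V a \<inter> membership_event V b)"
    unfolding event_prob_def
    by (simp add: Int_commute)
  then show ?thesis
    using assms by (simp add: event_prob_single membership_event_Int event_prob_pair
        field_simps del: insert_subset)
qed

text \<open>\<open>V\<close> is nonempty, so \<open>coeff_scale V\<close>, and with it every pair
  coefficient, is strictly below 1. This serves both condition (5) and the injectivity of
  \<open>membership_event V\<close>.\<close>

lemma event_prob_membership_diff_pos:
  assumes "a \<in> V" "b \<in> V" "a \<noteq> b"
  shows "event_prob dens (membership_event V b - membership_event V a) > 0"
proof -
  have "pair_coeff V u {a, b} < 1"
    using pair_coeff_bounds(2)[of V u "{a, b}"] coeff_scale_less_1[OF fin] assms(1) by force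
  then show ?thesis using event_prob_membership_diff[OF assms] by simp
qed

lemma inj_on_membership_event: "inj_on (membership_event V) V"
proof (rule inj_onI, rule ccontr)
  fix a b assume "a \<in> V" "b \<in> V" "membership_event V a = membership_event V b" "a \<noteq> b"
  then show False
    using event_prob_membership_diff_pos[of a b] by (simp add: event_prob_def)
qed

text \<open>Condition (5) separates \<open>b\<close> from \<open>a\<close> and \<open>c\<close>. If
  \<open>a = c\<close>, condition (2) would make the conditional probability
  \<open>(1 + pair_coeff V u {a, b}) / 2\<close> exceed 1.\<close>

lemma causally_between_distinct:
  assumes abc: "a \<in> V" "b \<in> V" "c \<in> V"
    and cb: "causally_between dens (membership_event V a) (membership_event V b) (membership_event V c)"
  shows "a \<noteq> b \<and> b \<noteq> c \<and> a \<noteq> c"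
proof -
  have "a \<noteq> b" "b \<noteq> c"
    using cb by (auto simp: causally_between_def event_prob_def)
  moreover have "a \<noteq> c"
  proof
    assume "a = c"
    then have "event_cond_prob dens (membership_event V a) (membership_event V b)
        > event_cond_prob dens (membership_event V a) (membership_event V a)"
      using cb by (simp add: causally_between_def)
    moreover have "pair_coeff V u {a, b} < 1"
      using pair_coeff_bounds(2)[of V u "{a, b}"] coeff_scale_less_1[OF fin] abc(1) by force
    ultimately show False
      using abc \<open>a \<noteq> b\<close>
      by (simp add: event_cond_prob_def membership_event_Int event_prob_pair event_prob_single
          del: insert_subset)
  qed
  ultimately show ?thesis by blast
qed

text \<open>As all three events have probability 1/2, (1) says that a pair coefficient is positive,
  (2) and (3) compare pair coefficients, and (4) is
  \<open>1 + x + y + z + w = (1 + x) * (1 + z)\<close> with \<open>x\<close>, \<open>y\<close>,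
  \<open>z\<close>, \<open>w\<close> the coefficients at \<open>{a, b}\<close>,
  \<open>{a, c}\<close>, \<open>{b, c}\<close>, \<open>{a, b, c}\<close>.\<close>

lemma causally_between_membership_iff:
  assumes abc: "a \<in> V" "b \<in> V" "c \<in> V" and neq: "a \<noteq> b" "b \<noteq> c" "a \<noteq> c"
  shows "causally_between dens (membership_event V a) (membership_event V b) (membership_event V c)
    \<longleftrightarrow> strictly_between (u a) (u b) (u c) \<and>
        pair_coeff V u {a, c} + triple_coeffs V R u {a, b, c}
          = pair_coeff V u {a, b} * pair_coeff V u {b, c}"
proof -
  let ?E = "membership_event V"
  have Pac: "event_prob dens (?E a \<inter> ?E c) = (1 + pair_coeff V u {a, c}) / 4"
    and Pab: "event_prob dens (?E a \<inter> ?E b) = (1 + pair_coeff V u {a, b}) / 4"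
    and Pcb: "event_prob dens (?E c \<inter> ?E b) = (1 + pair_coeff V u {b, c}) / 4"
    and Pca: "event_prob dens (?E c \<inter> ?E a) = (1 + pair_coeff V u {a, c}) / 4"
    unfolding membership_event_Int
    using abc neq event_prob_pair[of a c] event_prob_pair[of a b] event_prob_pair[of c b]
      event_prob_pair[of c a] by (simp_all add: insert_commute del: insert_subset)
  have "?E a \<inter> ?E c \<inter> ?E b = {s. s \<subseteq> V \<and> {a, b, c} \<subseteq> s}"
    by (auto simp: membership_event_def)
  then have Pacb: "event_prob dens (?E a \<inter> ?E c \<inter> ?E b) =
    (1 + pair_coeff V u {a, b} + pair_coeff V u {a, c} + pair_coeff V u {b, c}
       + triple_coeffs V R u {a, b, c}) / 8"
    using event_prob_triple[OF abc] neq by simp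
  have diffs: "event_prob dens (?E b - ?E a) > 0" "event_prob dens (?E b - ?E c) > 0"
    using event_prob_membership_diff_pos abc neq by auto
  show ?thesis
    unfolding causally_between_def event_cond_prob_def Pacb Pac Pab Pcb Pca
      event_prob_single[OF abc(1)] event_prob_single[OF abc(2)] event_prob_single[OF abc(3)]
    using diffs pair_coeff_bounds(1)[of V u "{a, c}"]
    unfolding strictly_between_iff_spread pair_coeff_less_iff[of V, symmetric]
    by (auto simp: field_simps)
qed

end

theorem corollary2:
  fixes V :: "'a set" and R :: "('a \<times> 'a \<times> 'a) set"
  assumes "finite V"
    and "betweenness_on V R"
    and "totally_orderable_on V R"
  shows "abstract_causal_betweenness_on V R"
proof -
  have R: "R \<subseteq> V \<times> V \<times> V"
    using assms(2) by (simp add: betweenness_on_def)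
  obtain u :: "'a \<Rightarrow> nat" where
    u: "\<And>a b c. (a, b, c) \<in> R \<Longrightarrow> strictly_between (u a) (u b) (u c)"
    using totally_orderable_on_rank[OF assms(1) R assms(3)] by blast
  let ?p = "walsh_density V (triple_coeffs V R u)"
  let ?E = "membership_event V"
  have space: "finite_prob_space (Pow V) ?p"
    using assms(1) abs_triple_coeffs_le[of _ V R u]
    by (intro finite_prob_space_walsh_density) (auto simp: triple_coeffs_def coeff_scale_def)
  have cb: "(a, b, c) \<in> R \<longleftrightarrow> causally_between ?p (?E a) (?E b) (?E c)"
    if abc: "a \<in> V" "b \<in> V" "c \<in> V" for a b c
  \<comment> \<open>Outside this case both sides are false, so only the equation for (4) has to be
    matched with \<open>R\<close>.\<close>
  proof (cases "a \<noteq> b \<and> b \<noteq> c \<and> a \<noteq> c \<and> strictly_between (u a) (u b) (u c)")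
    case True
    then have neq: "a \<noteq> b" "b \<noteq> c" "a \<noteq> c" and bet: "strictly_between (u a) (u b) (u c)"
      by auto
    have "card {a, b, c} = 3" using neq by simp
    then have "triple_coeffs V R u {a, b, c} =
        coeff_scale V * pair_coeff V u {a, c} - (if (a, b, c) \<in> R then pair_coeff V u {a, c} else 0)"
      using middle_triple_in_iff[of V R u a b c, OF assms(2) u bet] spread_strictly_between(1)[of u a b c, OF bet]
      unfolding triple_coeffs_def pair_coeff_def by simp
    \<comment> \<open>Spreads add along the line, while the product carries two factors
      \<open>coeff_scale V\<close>, one more than a pair coefficient.\<close>
    moreover have "pair_coeff V u {a, b} * pair_coeff V u {b, c} =
        coeff_scale V * pair_coeff V u {a, c}"
      by (simp add: pair_coeff_def flip: spread_strictly_between(2)[of u a b c, OF bet] power_add)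
    \<comment> \<open>The two sides of the equation agree if \<open>(a, b, c) \<in> R\<close>, and
      otherwise differ by the positive number \<open>pair_coeff V u {a, c}\<close>.\<close>
    ultimately show ?thesis
      using causally_between_membership_iff[OF assms(1) abc neq] bet
        pair_coeff_bounds(1)[of V u "{a, c}"] by simp
  next
    case False
    moreover have "a \<noteq> b \<and> b \<noteq> c \<and> a \<noteq> c" if "(a, b, c) \<in> R"
      using assms(2) that abc unfolding betweenness_on_def by blast
    ultimately show ?thesis
      using u causally_between_distinct[OF assms(1) abc] causally_between_membership_iff[OF assms(1) abc]
      by blast
  qed
  have "bij_betw ?E V (?E ` V)"
    using inj_on_membership_event[OF assms(1)] by (rule inj_on_imp_bij_betw)
  then have "ternary_isomorphic V R (?E ` V) (causal_betweenness ?p (?E ` V))"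
    unfolding ternary_isomorphic_def causal_betweenness_def using cb by auto
  moreover have "?E ` V \<subseteq> Pow (Pow V)"
    by (auto simp: membership_event_def)
  ultimately show ?thesis
    using abstract_causal_betweenness_onI[OF assms(1) R space] by blast
qed

end
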